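(* Let $\Omega\subseteq\mathbb{R}^3$ be a bounded domain, $\mathscr{C}=\Omega\times(0,\infty)$, and let $w:\mathscr{C}\to\mathbb{B}$ be a function in $C^{1,1}(\mathscr{C},\mathbb{B})$, written $w=u+iv=(u_0+\vec u)+i(v_0+\vec v)$ with $u,v:\mathscr{C}\to\mathbb{H}$. Then, for each choice of sign (upper signs throughout, or lower signs throughout), $(D\pm i\partial_t)w=0$ in $\mathscr{C}$ if and only if the following system holds in $\mathscr{C}$: $$\begin{aligned}-\operatorname{div}\vec u&=\pm\partial_t v_0,\\ \nabla u_0+\operatorname{curl}\vec u&=\pm\partial_t\vec v,\\ -\operatorname{div}\vec v&=\mp\partial_t u_0,\\ \nabla v_0+\operatorname{curl}\vec v&=\mp\partial_t\vec u.\end{aligned}$$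
   Context: $\mathbb{H}$ denotes the real quaternions with units $e_0=1,e_1,e_2,e_3$, and $\mathbb{B}=\mathbb{H}+i\mathbb{H}$ the biquaternions, where the complex imaginary unit $i$ commutes with $e_1,e_2,e_3$. Each $w\in\mathbb{B}$ is written $w=u+iv$ with $u,v\in\mathbb{H}$; $u_0$ and $\vec u=\sum_{j=1}^3u_je_j$ are the scalar and vector parts of $u$ (similarly for $v$); vector parts are identified with elements of $\mathbb{R}^3$. $C^{1,1}(\mathscr{C},\mathbb{B})$ is the space of $\mathbb{B}$-valued functions on $\mathscr{C}$ with continuous first-order spatial and temporal partial derivatives. The Moisil--Teodorescu (Dirac) operator $D=\sum_{j=1}^3e_j\partial_j$ (with $\partial_j=\partial/\partial x_j$) acts by left multiplication in the spatial variables. *)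

theory Defs
  imports "HOL-Analysis.Analysis"
begin

section \<open>Quaternions\<close>

datatype quat = Quat (re0: real) (im1: real) (im2: real) (im3: real)

lemma quat_eq_iff: "x = y \<longleftrightarrow> re0 x = re0 y \<and> im1 x = im1 y \<and> im2 x = im2 y \<and> im3 x = im3 y"
  by (cases x; cases y) auto

instantiation quat :: ring_1
begin

definition "0 = Quat 0 0 0 0"
definition "1 = Quat 1 0 0 0"
definition "x + y = Quat (re0 x + re0 y) (im1 x + im1 y) (im2 x + im2 y) (im3 x + im3 y)"
definition "- x = Quat (- re0 x) (- im1 x) (- im2 x) (- im3 x)"
definition "x - y = Quat (re0 x - re0 y) (im1 x - im1 y) (im2 x - im2 y) (im3 x - im3 y)"

definition "x * y = Quat
  (re0 x * re0 y - im1 x * im1 y - im2 x * im2 y - im3 x * im3 y)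
  (re0 x * im1 y + im1 x * re0 y + im2 x * im3 y - im3 x * im2 y)
  (re0 x * im2 y - im1 x * im3 y + im2 x * re0 y + im3 x * im1 y)
  (re0 x * im3 y + im1 x * im2 y - im2 x * im1 y + im3 x * re0 y)"

instance
  by standard
    (simp_all add: quat_eq_iff zero_quat_def one_quat_def plus_quat_def uminus_quat_def
      minus_quat_def times_quat_def algebra_simps)

end

lemma quat_sel [simp]:
  "re0 0 = 0" "im1 0 = 0" "im2 0 = 0" "im3 0 = 0"
  "re0 1 = 1" "im1 1 = 0" "im2 1 = 0" "im3 1 = 0"
  "re0 (x + y) = re0 x + re0 y" "im1 (x + y) = im1 x + im1 y"
  "im2 (x + y) = im2 x + im2 y" "im3 (x + y) = im3 x + im3 y"
  "re0 (- x) = - re0 x" "im1 (- x) = - im1 x" "im2 (- x) = - im2 x" "im3 (- x) = - im3 x"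
  "re0 (x - y) = re0 x - re0 y" "im1 (x - y) = im1 x - im1 y"
  "im2 (x - y) = im2 x - im2 y" "im3 (x - y) = im3 x - im3 y"
  by (simp_all add: zero_quat_def one_quat_def plus_quat_def uminus_quat_def minus_quat_def)

instantiation quat :: real_algebra_1
begin

definition "r *\<^sub>R x = Quat (r * re0 x) (r * im1 x) (r * im2 x) (r * im3 x)"

instance
  by standard
    (simp_all add: quat_eq_iff scaleR_quat_def times_quat_def algebra_simps)

end

lemma quat_sel_scaleR [simp]:
  "re0 (r *\<^sub>R x) = r * re0 x" "im1 (r *\<^sub>R x) = r * im1 x"
  "im2 (r *\<^sub>R x) = r * im2 x" "im3 (r *\<^sub>R x) = r * im3 x"
  by (simp_all add: scaleR_quat_def)

instantiation quat :: real_normed_vector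
begin

definition "norm x = sqrt ((re0 x)\<^sup>2 + (im1 x)\<^sup>2 + (im2 x)\<^sup>2 + (im3 x)\<^sup>2)"
definition "sgn (x::quat) = x /\<^sub>R norm x"
definition "dist (x::quat) y = norm (x - y)"
definition "(uniformity :: (quat \<times> quat) filter) = (INF e\<in>{0<..}. principal {(x, y). dist x y < e})"
definition "open (U :: quat set) \<longleftrightarrow> (\<forall>x\<in>U. eventually (\<lambda>(x', y). x' = x \<longrightarrow> y \<in> U) uniformity)"

instance
proof
  fix x y :: quat and r :: real and S :: "quat set"
  have tuple: "norm z = norm (re0 z, im1 z, im2 z, im3 z)" for z :: quat
    by (simp add: norm_quat_def norm_prod_def add.assoc)
  show "norm x = 0 \<longleftrightarrow> x = 0"
    by (simp add: tuple quat_eq_iff zero_prod_def)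
  show "norm (x + y) \<le> norm x + norm y"
    using norm_triangle_ineq[of "(re0 x, im1 x, im2 x, im3 x)" "(re0 y, im1 y, im2 y, im3 y)"]
    by (simp add: tuple)
  show "norm (r *\<^sub>R x) = \<bar>r\<bar> * norm x"
    using norm_scaleR[of r "(re0 x, im1 x, im2 x, im3 x)"]
    by (simp add: tuple)
qed (rule sgn_quat_def dist_quat_def uniformity_quat_def open_quat_def)+

end

abbreviation scalar_part :: "quat \<Rightarrow> real" where
  "scalar_part \<equiv> re0"

definition vector_part :: "quat \<Rightarrow> real^3" where
  "vector_part q = vector [im1 q, im2 q, im3 q]"

definition quat_of_vec :: "real^3 \<Rightarrow> quat" where
  "quat_of_vec x = Quat 0 (x $ 1) (x $ 2) (x $ 3)"

definition qunit :: "3 \<Rightarrow> quat" where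
  "qunit j = quat_of_vec (axis j 1)"

lemma qunit_simps: "qunit 1 = Quat 0 1 0 0" "qunit 2 = Quat 0 0 1 0" "qunit 3 = Quat 0 0 0 1"
  by (simp_all add: qunit_def quat_of_vec_def axis_def)

lemma qunit_table:
  "qunit j * qunit j = - 1"
  "qunit 1 * qunit 2 = qunit 3" "qunit 2 * qunit 3 = qunit 1" "qunit 3 * qunit 1 = qunit 2"
  "qunit 2 * qunit 1 = - qunit 3" "qunit 3 * qunit 2 = - qunit 1" "qunit 1 * qunit 3 = - qunit 2"
  using exhaust_3[of j] by (auto simp: qunit_simps times_quat_def quat_eq_iff)

lemma quat_decomp:
  "q = scalar_part q *\<^sub>R 1 + (\<Sum>j\<in>UNIV. (vector_part q $ j) *\<^sub>R qunit j)"
  by (simp add: quat_eq_iff vector_part_def qunit_simps sum_3)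


section \<open>Biquaternions\<close>

text \<open>\<open>Biquat u v\<close> stands for \<open>u + iv\<close>, where the complex unit \<open>i\<close> is central.\<close>

datatype biquat = Biquat (bq_re: quat) (bq_im: quat)

lemma biquat_eq_iff: "x = y \<longleftrightarrow> bq_re x = bq_re y \<and> bq_im x = bq_im y"
  by (cases x; cases y) auto

instantiation biquat :: ring_1
begin

definition "0 = Biquat 0 0"
definition "1 = Biquat 1 0"
definition "x + y = Biquat (bq_re x + bq_re y) (bq_im x + bq_im y)"
definition "- x = Biquat (- bq_re x) (- bq_im x)"
definition "x - y = Biquat (bq_re x - bq_re y) (bq_im x - bq_im y)"
definition "x * y = Biquat (bq_re x * bq_re y - bq_im x * bq_im y) (bq_re x * bq_im y + bq_im x * bq_re y)"

instance
  by standard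
    (simp_all add: biquat_eq_iff zero_biquat_def one_biquat_def plus_biquat_def uminus_biquat_def
      minus_biquat_def times_biquat_def algebra_simps)

end

lemma biquat_sel [simp]:
  "bq_re 0 = 0" "bq_im 0 = 0" "bq_re 1 = 1" "bq_im 1 = 0"
  "bq_re (x + y) = bq_re x + bq_re y" "bq_im (x + y) = bq_im x + bq_im y"
  "bq_re (- x) = - bq_re x" "bq_im (- x) = - bq_im x"
  "bq_re (x - y) = bq_re x - bq_re y" "bq_im (x - y) = bq_im x - bq_im y"
  by (simp_all add: zero_biquat_def one_biquat_def plus_biquat_def uminus_biquat_def minus_biquat_def)

instantiation biquat :: real_algebra_1
begin

definition "r *\<^sub>R x = Biquat (r *\<^sub>R bq_re x) (r *\<^sub>R bq_im x)"

instance
  by standard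
    (simp_all add: biquat_eq_iff scaleR_biquat_def times_biquat_def algebra_simps)

end

lemma biquat_sel_scaleR [simp]:
  "bq_re (r *\<^sub>R x) = r *\<^sub>R bq_re x" "bq_im (r *\<^sub>R x) = r *\<^sub>R bq_im x"
  by (simp_all add: scaleR_biquat_def)

instantiation biquat :: real_normed_vector
begin

definition "norm x = sqrt ((norm (bq_re x))\<^sup>2 + (norm (bq_im x))\<^sup>2)"
definition "sgn (x::biquat) = x /\<^sub>R norm x"
definition "dist (x::biquat) y = norm (x - y)"
definition "(uniformity :: (biquat \<times> biquat) filter) = (INF e\<in>{0<..}. principal {(x, y). dist x y < e})"
definition "open (U :: biquat set) \<longleftrightarrow> (\<forall>x\<in>U. eventually (\<lambda>(x', y). x' = x \<longrightarrow> y \<in> U) uniformity)"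

instance
proof
  fix x y :: biquat and r :: real and S :: "biquat set"
  have pair: "norm z = norm (bq_re z, bq_im z)" for z :: biquat
    by (simp add: norm_biquat_def norm_prod_def)
  show "norm x = 0 \<longleftrightarrow> x = 0"
    by (simp add: pair biquat_eq_iff zero_prod_def)
  show "norm (x + y) \<le> norm x + norm y"
    using norm_triangle_ineq[of "(bq_re x, bq_im x)" "(bq_re y, bq_im y)"]
    by (simp add: pair)
  show "norm (r *\<^sub>R x) = \<bar>r\<bar> * norm x"
    using norm_scaleR[of r "(bq_re x, bq_im x)"]
    by (simp add: pair)
qed (rule sgn_biquat_def dist_biquat_def uniformity_biquat_def open_biquat_def)+

end

definition of_quat :: "quat \<Rightarrow> biquat" where
  "of_quat q = Biquat q 0"

definition imag_unit :: biquat where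
  "imag_unit = Biquat 0 1"

lemma of_quat_hom:
  "of_quat (p + q) = of_quat p + of_quat q" "of_quat (p * q) = of_quat p * of_quat q"
  "of_quat 1 = 1" "of_quat (r *\<^sub>R p) = r *\<^sub>R of_quat p"
  by (simp_all add: of_quat_def biquat_eq_iff times_biquat_def)

lemma imag_unit_square: "imag_unit * imag_unit = - 1"
  by (simp add: imag_unit_def biquat_eq_iff times_biquat_def)

lemma imag_unit_central: "imag_unit * w = w * imag_unit"
  by (simp add: imag_unit_def biquat_eq_iff times_biquat_def)

lemma biquat_decomp_iff: "w = of_quat u + imag_unit * of_quat v \<longleftrightarrow> u = bq_re w \<and> v = bq_im w"
  by (auto simp: of_quat_def imag_unit_def biquat_eq_iff times_biquat_def)


section \<open>Differential operators on space-time\<close>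

text \<open>Space-time points are pairs \<open>(x, t)\<close>. The partial derivatives below use
  \<^const>\<open>vector_derivative\<close>, so they are meaningful only where the corresponding
  one-variable function is differentiable.\<close>

definition partial_x :: "3 \<Rightarrow> ((real^3) \<times> real \<Rightarrow> 'a::real_normed_vector) \<Rightarrow> (real^3) \<times> real \<Rightarrow> 'a" where
  "partial_x j f = (\<lambda>(x, t). vector_derivative (\<lambda>s. f (x + s *\<^sub>R axis j 1, t)) (at 0))"

definition partial_t :: "((real^3) \<times> real \<Rightarrow> 'a::real_normed_vector) \<Rightarrow> (real^3) \<times> real \<Rightarrow> 'a" where
  "partial_t f = (\<lambda>(x, t). vector_derivative (\<lambda>s. f (x, s)) (at t))"

definition C11_on :: "((real^3) \<times> real) set \<Rightarrow> ((real^3) \<times> real \<Rightarrow> 'a::real_normed_vector) \<Rightarrow> bool" where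
  "C11_on S f \<longleftrightarrow>
     (\<forall>(x, t)\<in>S. (\<forall>j. (\<lambda>s. f (x + s *\<^sub>R axis j 1, t)) differentiable (at 0)) \<and>
                 (\<lambda>s. f (x, s)) differentiable (at t)) \<and>
     (\<forall>j. continuous_on S (partial_x j f)) \<and> continuous_on S (partial_t f)"

definition grad :: "((real^3) \<times> real \<Rightarrow> real) \<Rightarrow> (real^3) \<times> real \<Rightarrow> real^3" where
  "grad f p = (\<chi> j. partial_x j f p)"

definition divergence :: "((real^3) \<times> real \<Rightarrow> real^3) \<Rightarrow> (real^3) \<times> real \<Rightarrow> real" where
  "divergence F p = (\<Sum>j\<in>UNIV. partial_x j (\<lambda>q. F q $ j) p)"

definition curl :: "((real^3) \<times> real \<Rightarrow> real^3) \<Rightarrow> (real^3) \<times> real \<Rightarrow> real^3" where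
  "curl F p = vector
     [partial_x 2 (\<lambda>q. F q $ 3) p - partial_x 3 (\<lambda>q. F q $ 2) p,
      partial_x 3 (\<lambda>q. F q $ 1) p - partial_x 1 (\<lambda>q. F q $ 3) p,
      partial_x 1 (\<lambda>q. F q $ 2) p - partial_x 2 (\<lambda>q. F q $ 1) p]"

definition dirac :: "((real^3) \<times> real \<Rightarrow> biquat) \<Rightarrow> (real^3) \<times> real \<Rightarrow> biquat" where
  "dirac w p = (\<Sum>j\<in>UNIV. of_quat (qunit j) * partial_x j w p)"

end

theory Submission
  imports Defs
begin

text \<open>
  Multiplication by the unit \<open>e\<^sub>j\<close> acts on the real part \<open>u\<close> and on the imaginary part \<open>v\<close> of a
  biquaternion separately, because \<open>i\<close> is central. Hence
  \<open>(D + \<sigma> i \<partial>\<^sub>t) w = (D u - \<sigma> \<partial>\<^sub>t v) + i (D v + \<sigma> \<partial>\<^sub>t u)\<close>, and the equation for \<open>w\<close> says that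
  \<open>D u = \<sigma> \<partial>\<^sub>t v\<close> and \<open>D v = - \<sigma> \<partial>\<^sub>t u\<close>. The product of two vectors \<open>a\<close>, \<open>b\<close> in the quaternions
  is \<open>- a \<bullet> b + a \<times> b\<close>. Formally with \<open>a = \<nabla>\<close> this gives
  \<open>D u = - div u' + (\<nabla> u\<^sub>0 + curl u')\<close>, where \<open>u'\<close> is the vector part of \<open>u\<close>, which splits
  \<open>D u\<close> into its scalar and its vector part (\<open>dirac_component\<close>). Comparing
  scalar and vector parts in both quaternionic equations gives the four equations of the system.

  The analytic content is that a partial derivative of a component of \<open>w\<close> is the component of the
  partial derivative of \<open>w\<close>. The components are bounded linear maps, and the functions \<open>u\<close>, \<open>v\<close>
  agree with components of \<open>w\<close> on an open set, which suffices because a partial derivative at a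
  point depends only on values near that point (\<open>partial_x_bounded_linear\<close> and
  \<open>partial_t_bounded_linear\<close>).
\<close>

lemma bounded_linear_re0: "bounded_linear re0"
  and bounded_linear_vector_part: "bounded_linear vector_part"
proof -
  show "bounded_linear re0"
  proof (rule bounded_linear_intro[where K = 1])
    show "norm (re0 x) \<le> norm x * 1" for x
      by (auto simp: norm_quat_def add.assoc intro!: real_le_rsqrt)
  qed simp_all
  show "bounded_linear vector_part"
  proof (rule bounded_linear_intro[where K = 1])
    show "norm (vector_part x) \<le> norm x * 1" for x
      by (auto simp: norm_quat_def norm_vec_def L2_set_def sum_3 vector_part_def)
  qed (simp_all add: vector_part_def vec_eq_iff forall_3)
qed

lemma bounded_linear_bq_re: "bounded_linear bq_re"
  and bounded_linear_bq_im: "bounded_linear bq_im"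
proof -
  show "bounded_linear bq_re"
  proof (rule bounded_linear_intro[where K = 1])
    show "norm (bq_re x) \<le> norm x * 1" for x
      by (auto simp: norm_biquat_def intro!: real_le_rsqrt)
  qed simp_all
  show "bounded_linear bq_im"
  proof (rule bounded_linear_intro[where K = 1])
    show "norm (bq_im x) \<le> norm x * 1" for x
      by (auto simp: norm_biquat_def intro!: real_le_rsqrt)
  qed simp_all
qed

text \<open>The common core of the spatial and the temporal case: both partial derivatives are derivatives
  along a curve \<open>c\<close> in space-time, and the curve stays in the open set for parameters near \<open>a\<close>.\<close>

lemma vector_derivative_along_curve_bounded_linear:
  fixes f :: "'p::topological_space \<Rightarrow> 'b::real_normed_vector"
    and g :: "'p \<Rightarrow> 'c::real_normed_vector"
  assumes L: "bounded_linear L" and S: "open S" "c a \<in> S" and c: "continuous_on UNIV c"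
    and diff: "(\<lambda>s. f (c s)) differentiable (at a)"
    and g: "\<And>q. q \<in> S \<Longrightarrow> g q = L (f q)"
  shows "vector_derivative (\<lambda>s. g (c s)) (at a) = L (vector_derivative (\<lambda>s. f (c s)) (at a))"
proof (rule vector_derivative_at)
  have "((\<lambda>s. f (c s)) has_vector_derivative vector_derivative (\<lambda>s. f (c s)) (at a)) (at a)"
    using diff by (simp add: vector_derivative_works)
  then have "((\<lambda>s. L (f (c s))) has_vector_derivative
      L (vector_derivative (\<lambda>s. f (c s)) (at a))) (at a)"
    by (rule bounded_linear.has_vector_derivative[OF L])
  moreover have "open (c -` S)"
    using c S(1) by (simp add: continuous_on_open_vimage)
  ultimately show "((\<lambda>s. g (c s)) has_vector_derivative
      L (vector_derivative (\<lambda>s. f (c s)) (at a))) (at a)"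
    by (rule has_vector_derivative_transform_within_open) (use S g in auto)
qed

lemma partial_x_bounded_linear:
  assumes "bounded_linear L" "C11_on S f" "open S" "p \<in> S" "\<And>q. q \<in> S \<Longrightarrow> g q = L (f q)"
  shows "partial_x j g p = L (partial_x j f p)"
proof (cases p)
  case (Pair x t)
  show ?thesis
    unfolding partial_x_def Pair prod.case
    by (rule vector_derivative_along_curve_bounded_linear[where S = S and L = L])
      (use assms Pair in \<open>auto simp: C11_on_def intro!: continuous_intros\<close>)
qed

lemma partial_t_bounded_linear:
  assumes "bounded_linear L" "C11_on S f" "open S" "p \<in> S" "\<And>q. q \<in> S \<Longrightarrow> g q = L (f q)"
  shows "partial_t g p = L (partial_t f p)"
proof (cases p)
  case (Pair x t)
  show ?thesis
    unfolding partial_t_def Pair prod.case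
    by (rule vector_derivative_along_curve_bounded_linear[where S = S and L = L])
      (use assms Pair in \<open>auto simp: C11_on_def intro!: continuous_intros\<close>)
qed

lemma quat_eq_iff_parts:
  "a = b \<longleftrightarrow> scalar_part a = scalar_part b \<and> vector_part a = vector_part b"
  by (auto simp: quat_eq_iff vector_part_def vec_eq_iff forall_3)

text \<open>The map \<open>L\<close> stands for either the real or the imaginary part. Being bounded linear it
  commutes with the partial derivatives, and it is compatible with left multiplication by
  quaternions, so that \<open>L (D w) = D (L w)\<close>; the multiplication table of the units then produces
  the divergence, the gradient and the curl.\<close>

lemma dirac_component:
  assumes L: "bounded_linear L" and mult: "\<And>a b. L (of_quat a * b) = a * L b"
    and w: "C11_on S w" and S: "open S" "p \<in> S"
    and h: "\<And>q. q \<in> S \<Longrightarrow> h q = L (w q)"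
  shows "scalar_part (L (dirac w p)) = - divergence (\<lambda>q. vector_part (h q)) p"
    and "vector_part (L (dirac w p)) =
      grad (\<lambda>q. scalar_part (h q)) p + curl (\<lambda>q. vector_part (h q)) p"
proof -
  have scalar: "partial_x j (\<lambda>q. scalar_part (h q)) p = scalar_part (L (partial_x j w p))" for j
    by (rule partial_x_bounded_linear[OF bounded_linear_compose[OF bounded_linear_re0 L] w S])
      (simp add: h)
  have vector: "partial_x j (\<lambda>q. vector_part (h q) $ k) p = vector_part (L (partial_x j w p)) $ k"
    for j k
    by (rule partial_x_bounded_linear[OF bounded_linear_compose[OF bounded_linear_vec_nth
          bounded_linear_compose[OF bounded_linear_vector_part L]] w S])
      (simp add: h)
  have "L (dirac w p) = (\<Sum>j\<in>UNIV. qunit j * L (partial_x j w p))"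
    by (simp add: dirac_def linear_sum[OF bounded_linear.linear[OF L]] mult)
  then have D: "L (dirac w p) = qunit 1 * L (partial_x 1 w p) + qunit 2 * L (partial_x 2 w p)
      + qunit 3 * L (partial_x 3 w p)"
    by (simp add: sum_3)
  show "scalar_part (L (dirac w p)) = - divergence (\<lambda>q. vector_part (h q)) p"
    unfolding divergence_def vector D
    by (simp add: sum_3 vector_part_def qunit_simps times_quat_def)
  show "vector_part (L (dirac w p)) =
      grad (\<lambda>q. scalar_part (h q)) p + curl (\<lambda>q. vector_part (h q)) p"
    unfolding grad_def curl_def vector scalar D
    by (simp add: vector_part_def qunit_simps times_quat_def vec_eq_iff forall_3)
qed

theorem proposition4:
  fixes \<Omega> :: "(real^3) set"
    and w :: "(real^3) \<times> real \<Rightarrow> biquat"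
    and u v :: "(real^3) \<times> real \<Rightarrow> quat"
    and \<sigma> :: real
  assumes "open \<Omega>" and "connected \<Omega>" and "\<Omega> \<noteq> {}" and "bounded \<Omega>"
    and "C11_on (\<Omega> \<times> {0<..}) w"
    and "\<forall>p\<in>\<Omega> \<times> {0<..}. w p = of_quat (u p) + imag_unit * of_quat (v p)"
    and "\<sigma> = 1 \<or> \<sigma> = - 1"
  shows "(\<forall>p\<in>\<Omega> \<times> {0<..}. dirac w p + \<sigma> *\<^sub>R (imag_unit * partial_t w p) = 0) \<longleftrightarrow>
    (\<forall>p\<in>\<Omega> \<times> {0<..}.
       - divergence (\<lambda>q. vector_part (u q)) p = \<sigma> * partial_t (\<lambda>q. scalar_part (v q)) p \<and>
       grad (\<lambda>q. scalar_part (u q)) p + curl (\<lambda>q. vector_part (u q)) p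
         = \<sigma> *\<^sub>R partial_t (\<lambda>q. vector_part (v q)) p \<and>
       - divergence (\<lambda>q. vector_part (v q)) p = - \<sigma> * partial_t (\<lambda>q. scalar_part (u q)) p \<and>
       grad (\<lambda>q. scalar_part (v q)) p + curl (\<lambda>q. vector_part (v q)) p
         = - \<sigma> *\<^sub>R partial_t (\<lambda>q. vector_part (u q)) p)"
proof (rule ball_cong[OF refl])
  fix p :: "(real^3) \<times> real"
  assume p: "p \<in> \<Omega> \<times> {0<..}"
  let ?S = "\<Omega> \<times> {0<..} :: ((real^3) \<times> real) set"
  have S: "open ?S"
    using assms(1) by (simp add: open_Times)
  note w = assms(5)
  have u: "u q = bq_re (w q)" and v: "v q = bq_im (w q)" if "q \<in> ?S" for q
    using assms(6) that biquat_decomp_iff by blast+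
  have re_mult: "bq_re (of_quat a * b) = a * bq_re b"
    and im_mult: "bq_im (of_quat a * b) = a * bq_im b" for a b
    by (simp_all add: of_quat_def times_biquat_def)
  have Du:
    "scalar_part (bq_re (dirac w p)) = - divergence (\<lambda>q. vector_part (u q)) p"
    "vector_part (bq_re (dirac w p)) =
      grad (\<lambda>q. scalar_part (u q)) p + curl (\<lambda>q. vector_part (u q)) p"
    by (rule dirac_component[OF bounded_linear_bq_re re_mult w S p]; simp add: u)+
  have Dv:
    "scalar_part (bq_im (dirac w p)) = - divergence (\<lambda>q. vector_part (v q)) p"
    "vector_part (bq_im (dirac w p)) =
      grad (\<lambda>q. scalar_part (v q)) p + curl (\<lambda>q. vector_part (v q)) p"
    by (rule dirac_component[OF bounded_linear_bq_im im_mult w S p]; simp add: v)+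
  note re0 = bounded_linear_compose[OF bounded_linear_re0]
  note vec = bounded_linear_compose[OF bounded_linear_vector_part]
  have u_t:
    "partial_t (\<lambda>q. scalar_part (u q)) p = scalar_part (bq_re (partial_t w p))"
    "partial_t (\<lambda>q. vector_part (u q)) p = vector_part (bq_re (partial_t w p))"
    by (rule partial_t_bounded_linear[OF re0[OF bounded_linear_bq_re] w S p],
        simp add: u,
        rule partial_t_bounded_linear[OF vec[OF bounded_linear_bq_re] w S p],
        simp add: u)
  have v_t:
    "partial_t (\<lambda>q. scalar_part (v q)) p = scalar_part (bq_im (partial_t w p))"
    "partial_t (\<lambda>q. vector_part (v q)) p = vector_part (bq_im (partial_t w p))"
    by (rule partial_t_bounded_linear[OF re0[OF bounded_linear_bq_im] w S p],
        simp add: v,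
        rule partial_t_bounded_linear[OF vec[OF bounded_linear_bq_im] w S p],
        simp add: v)
  have "dirac w p + \<sigma> *\<^sub>R (imag_unit * partial_t w p) = 0 \<longleftrightarrow>
      bq_re (dirac w p) = \<sigma> *\<^sub>R bq_im (partial_t w p) \<and>
      bq_im (dirac w p) = (- \<sigma>) *\<^sub>R bq_re (partial_t w p)"
    by (simp add: biquat_eq_iff imag_unit_def times_biquat_def eq_neg_iff_add_eq_0)
  then show "dirac w p + \<sigma> *\<^sub>R (imag_unit * partial_t w p) = 0 \<longleftrightarrow>
       - divergence (\<lambda>q. vector_part (u q)) p = \<sigma> * partial_t (\<lambda>q. scalar_part (v q)) p \<and>
       grad (\<lambda>q. scalar_part (u q)) p + curl (\<lambda>q. vector_part (u q)) p
         = \<sigma> *\<^sub>R partial_t (\<lambda>q. vector_part (v q)) p \<and>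
       - divergence (\<lambda>q. vector_part (v q)) p = - \<sigma> * partial_t (\<lambda>q. scalar_part (u q)) p \<and>
       grad (\<lambda>q. scalar_part (v q)) p + curl (\<lambda>q. vector_part (v q)) p
         = - \<sigma> *\<^sub>R partial_t (\<lambda>q. vector_part (u q)) p"
    unfolding u_t v_t Du[symmetric] Dv[symmetric]
    by (simp only: quat_eq_iff_parts quat_sel_scaleR conj_assoc
        linear_cmul[OF bounded_linear.linear[OF bounded_linear_vector_part]])
qed

end
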